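(* Let $X$ be a finite metric space, $\#X=n\ge2$, with $\mathrm{mst}$-spectrum $(\sigma_1,\ldots,\sigma_{n-1})$ and $\mathrm{xst}$-spectrum $(\Sigma_1,\ldots,\Sigma_{n-1})$, and let $\lambda>0$. Then $$2d_{GH}(\lambda\Delta_{n-1},X)=\max\{\sigma_{n-1},\ \lambda-\sigma_{n-2},\ \Sigma_{n-1}-\lambda\}.$$ Moreover, the correspondence that takes one of the elements of the simplex $\lambda\Delta_{n-1}$ to a pair $\{x,y\}$ of closest points of $X$ (i.e. $x\neq y$ with $|xy|$ the smallest nonzero distance in $X$), and that is one-to-one on the remaining elements (between the remaining elements of the simplex and $X\setminus\{x,y\}$), is optimal.
   Context: $\#X$ is the cardinality of $X$, $|xy|$ is the distance between points $x,y$, and $d_{GH}$ is the Gromov--Hausdorff distance. $\lambda\Delta_m$ denotes the $m$-point metric space (simplex) all of whose nonzero distances equal $\lambda$. For a tree with vertex set $X$, the length of an edge $xy$ is $|xy|$ and the length of the tree is the sum of its edge lengths; a minimum (respectively maximum) spanning tree on $X$ is a tree with vertex set $X$ of smallest (respectively largest) length. The $\mathrm{mst}$-spectrum $(\sigma_1,\ldots,\sigma_{n-1})$ of $X$ is the vector of edge lengths of any minimum spanning tree on $X$ in descending order; the $\mathrm{xst}$-spectrum $(\Sigma_1,\ldots,\Sigma_{n-1})$ is the vector of edge lengths of any maximum spanning tree on $X$ in ascending order; both are independent of the choice of tree. A correspondence between sets $Y$ and $X$ is a subset $R\subset Y\times X$ whose projections to $Y$ and to $X$ are both surjective. Its distortion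 for metric spaces $Y,X$ is $\operatorname{dis}R=\sup\{\,\bigl||yy'|-|xx'|\bigr|:(y,x),(y',x')\in R\}$. A correspondence $R$ is optimal if $d_{GH}(Y,X)=\frac12\operatorname{dis}R$.
   Formalization: For n = 2 the mst-spectrum is just (σ_1), so σ_{n−2} = σ_0 is undefined; the formal statement omits the term λ − σ_{n−2} from the maximum in that case and keeps the formula unchanged for n ≥ 3. *)

theory Defs
  imports "HOL-Analysis.Analysis"
begin

section \<open>Gromov--Hausdorff distance and correspondences\<close>

text \<open>
  The two distances and the distortion below are real-valued. They are meant for nonempty
  bounded metric spaces, where the infima and suprema are those of nonempty sets of reals
  bounded below and above, respectively.
\<close>

definition hausdorff_distance :: "('a \<Rightarrow> 'a \<Rightarrow> real) \<Rightarrow> 'a set \<Rightarrow> 'a set \<Rightarrow> real" where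
  "hausdorff_distance d A B =
     Inf {r. 0 < r \<and> (\<forall>a\<in>A. \<exists>b\<in>B. d a b < r) \<and> (\<forall>b\<in>B. \<exists>a\<in>A. d a b < r)}"

definition isometric_embedding ::
  "'a set \<Rightarrow> ('a \<Rightarrow> 'a \<Rightarrow> real) \<Rightarrow> 'b set \<Rightarrow> ('b \<Rightarrow> 'b \<Rightarrow> real) \<Rightarrow> ('a \<Rightarrow> 'b) \<Rightarrow> bool" where
  "isometric_embedding X dX Z dZ f \<longleftrightarrow>
     f \<in> X \<rightarrow> Z \<and> (\<forall>x\<in>X. \<forall>x'\<in>X. dZ (f x) (f x') = dX x x')"

text \<open>
  The infimum runs over all metric spaces containing isometric copies of both spaces. HOL cannot
  quantify over all types, but ambient spaces on subsets of the sum type suffice: the Hausdorff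
  distance only depends on the union of the two copies, and any such union (whether or not the
  copies overlap) injects into the sum type.
\<close>

definition GH_distance ::
  "'b set \<Rightarrow> ('b \<Rightarrow> 'b \<Rightarrow> real) \<Rightarrow> 'a set \<Rightarrow> ('a \<Rightarrow> 'a \<Rightarrow> real) \<Rightarrow> real" where
  "GH_distance Y dY X dX =
     Inf {hausdorff_distance dZ (f ` Y) (g ` X) |
            (Z :: ('b + 'a) set) (dZ :: 'b + 'a \<Rightarrow> 'b + 'a \<Rightarrow> real) f g.
            Metric_space Z dZ \<and> isometric_embedding Y dY Z dZ f \<and> isometric_embedding X dX Z dZ g}"

definition correspondence :: "'b set \<Rightarrow> 'a set \<Rightarrow> ('b \<times> 'a) set \<Rightarrow> bool" where
  "correspondence Y X R \<longleftrightarrow> R \<subseteq> Y \<times> X \<and> fst ` R = Y \<and> snd ` R = X"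

definition distortion ::
  "('b \<Rightarrow> 'b \<Rightarrow> real) \<Rightarrow> ('a \<Rightarrow> 'a \<Rightarrow> real) \<Rightarrow> ('b \<times> 'a) set \<Rightarrow> real" where
  "distortion dY dX R =
     Sup {\<bar>dY y y' - dX x x'\<bar> | y x y' x'. (y, x) \<in> R \<and> (y', x') \<in> R}"

definition optimal_correspondence ::
  "'b set \<Rightarrow> ('b \<Rightarrow> 'b \<Rightarrow> real) \<Rightarrow> 'a set \<Rightarrow> ('a \<Rightarrow> 'a \<Rightarrow> real) \<Rightarrow> ('b \<times> 'a) set \<Rightarrow> bool" where
  "optimal_correspondence Y dY X dX R \<longleftrightarrow>
     correspondence Y X R \<and> GH_distance Y dY X dX = 1 / 2 * distortion dY dX R"

text \<open>The simplex \<open>\<lambda>\<Delta>\<^sub>m\<close> is the set \<open>{..<m}\<close> with the metric \<open>simplex_dist \<lambda>\<close>.\<close>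

definition simplex_dist :: "real \<Rightarrow> nat \<Rightarrow> nat \<Rightarrow> real" where
  "simplex_dist l i j = (if i = j then 0 else l)"

lemma Metric_space_simplex:
  assumes "0 < l"
  shows "Metric_space {..<m} (simplex_dist l)"
  using assms by unfold_locales (auto simp: simplex_dist_def)


section \<open>Spanning trees and their spectra\<close>

text \<open>
  A simple graph on \<open>X\<close> is given by its set of edges, which are two-element subsets of \<open>X\<close>.
  A cycle is given by the list of its (at least three) distinct vertices.
\<close>

definition graph_cycle :: "'a set set \<Rightarrow> 'a list \<Rightarrow> bool" where
  "graph_cycle T c \<longleftrightarrow> 3 \<le> length c \<and> distinct c \<and>
     (\<forall>i<length c. {c ! i, c ! (Suc i mod length c)} \<in> T)"

definition tree_on :: "'a set \<Rightarrow> 'a set set \<Rightarrow> bool" where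
  "tree_on X T \<longleftrightarrow>
     T \<subseteq> {{x, y} | x y. x \<in> X \<and> y \<in> X \<and> x \<noteq> y} \<and>
     (\<forall>x\<in>X. \<forall>y\<in>X. (x, y) \<in> {(u, v). {u, v} \<in> T}\<^sup>*) \<and>
     \<not> (\<exists>c. graph_cycle T c)"

definition edge_length :: "('a \<Rightarrow> 'a \<Rightarrow> real) \<Rightarrow> 'a set \<Rightarrow> real" where
  "edge_length d e = (THE r. \<exists>x y. e = {x, y} \<and> r = d x y)"

definition tree_length :: "('a \<Rightarrow> 'a \<Rightarrow> real) \<Rightarrow> 'a set set \<Rightarrow> real" where
  "tree_length d T = (\<Sum>e\<in>T. edge_length d e)"

definition minimum_spanning_tree :: "'a set \<Rightarrow> ('a \<Rightarrow> 'a \<Rightarrow> real) \<Rightarrow> 'a set set \<Rightarrow> bool" where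
  "minimum_spanning_tree X d T \<longleftrightarrow>
     tree_on X T \<and> (\<forall>T'. tree_on X T' \<longrightarrow> tree_length d T \<le> tree_length d T')"

definition maximum_spanning_tree :: "'a set \<Rightarrow> ('a \<Rightarrow> 'a \<Rightarrow> real) \<Rightarrow> 'a set set \<Rightarrow> bool" where
  "maximum_spanning_tree X d T \<longleftrightarrow>
     tree_on X T \<and> (\<forall>T'. tree_on X T' \<longrightarrow> tree_length d T' \<le> tree_length d T)"

text \<open>
  Vectors are functions on \<open>nat\<close> whose components are indexed from 1; values outside
  \<open>{1..card T}\<close> are irrelevant; in particular there is no component with index 0, so a spectrum
  of a two-point space (a single number) has no entry with index \<open>card X - 2\<close>. The following says that \<open>s 1, \<dots>, s (card T)\<close> lists the edge
  lengths of \<open>T\<close>, with multiplicity.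
\<close>

definition lists_edge_lengths :: "('a \<Rightarrow> 'a \<Rightarrow> real) \<Rightarrow> 'a set set \<Rightarrow> (nat \<Rightarrow> real) \<Rightarrow> bool" where
  "lists_edge_lengths d T s \<longleftrightarrow>
     image_mset s (mset_set {1..card T}) = image_mset (edge_length d) (mset_set T)"

text \<open>
  The spectra are relations, so that statements about \<open>s\<close> with \<open>mst_spectrum X d s\<close> cover every
  choice of the tree. The existence of both spectra is shown at the end.
\<close>

definition mst_spectrum :: "'a set \<Rightarrow> ('a \<Rightarrow> 'a \<Rightarrow> real) \<Rightarrow> (nat \<Rightarrow> real) \<Rightarrow> bool" where
  "mst_spectrum X d s \<longleftrightarrow>
     (\<exists>T. minimum_spanning_tree X d T \<and> lists_edge_lengths d T s \<and> antimono_on {1..card T} s)"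

definition xst_spectrum :: "'a set \<Rightarrow> ('a \<Rightarrow> 'a \<Rightarrow> real) \<Rightarrow> (nat \<Rightarrow> real) \<Rightarrow> bool" where
  "xst_spectrum X d s \<longleftrightarrow>
     (\<exists>T. maximum_spanning_tree X d T \<and> lists_edge_lengths d T s \<and> mono_on {1..card T} s)"

lemma edge_length_pair:
  assumes "\<And>x y. d x y = d y x"
  shows "edge_length d {x, y} = d x y"
  unfolding edge_length_def using assms by (intro the_equality) (auto simp: doubleton_eq_iff)

lemma tree_on_star:
  assumes "a \<in> X"
  shows "tree_on X ((\<lambda>x. {a, x}) ` (X - {a}))" (is "tree_on X ?T")
proof -
  let ?E = "{(u, v). {u, v} \<in> ?T}"
  have sub: "?T \<subseteq> {{x, y} | x y. x \<in> X \<and> y \<in> X \<and> x \<noteq> y}"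
    using assms by blast
  have conn: "(x, y) \<in> ?E\<^sup>*" if "x \<in> X" "y \<in> X" for x y
  proof -
    have "(x, a) \<in> ?E\<^sup>*"
      using that(1) by (cases "x = a") (auto intro!: r_into_rtrancl simp: insert_commute)
    moreover have "(a, y) \<in> ?E\<^sup>*"
      using that(2) by (cases "y = a") (auto intro!: r_into_rtrancl)
    ultimately show ?thesis by (rule rtrancl_trans)
  qed
  have "False" if "graph_cycle ?T c" for c
  proof -
    let ?n = "length c"
    have n: "3 \<le> ?n" and dis: "distinct c"
      and edge: "\<And>i. i < ?n \<Longrightarrow> {c ! i, c ! (Suc i mod ?n)} \<in> ?T"
      using that by (auto simp: graph_cycle_def)
    have a: "c ! i = a \<or> c ! (Suc i mod ?n) = a" if "i < ?n" for i
      using edge[OF that] by (auto simp: doubleton_eq_iff)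
    have at: "i = j" if "c ! i = a" "c ! j = a" "i < ?n" "j < ?n" for i j
      using that dis by (metis nth_eq_iff_index_eq)
    have e0: "c ! 0 = a \<or> c ! 1 = a" and e1: "c ! 1 = a \<or> c ! 2 = a"
      using a[of 0] a[of 1] n by (force simp: numeral_2_eq_2)+
    then have "c ! 1 = a" using at[of 0 2] n by force
    moreover have "c ! 2 = a \<or> c ! (Suc 2 mod ?n) = a" using a[of 2] n by simp
    moreover have "Suc 2 mod ?n < ?n" "Suc 2 mod ?n \<noteq> 1"
      using n by (auto simp: mod_if)
    ultimately show False using at[of 1 2] at[of 1 "Suc 2 mod ?n"] n by force
  qed
  then show ?thesis using sub conn unfolding tree_on_def by (intro conjI ballI notI) (assumption | elim exE)+
qed

lemma finite_trees: "finite X \<Longrightarrow> finite {T. tree_on X T}"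
  by (rule finite_subset[of _ "Pow (Pow X)"]) (auto simp: tree_on_def)

lemma lists_edge_lengths_ex:
  obtains s where "lists_edge_lengths d T s" "mono_on {1..card T} s"
proof -
  let ?xs = "sorted_list_of_multiset (image_mset (edge_length d) (mset_set T))"
  define s where "s i = ?xs ! (i - 1)" for i
  have len: "length ?xs = card T"
    by (metis mset_sorted_list_of_multiset size_mset size_image_mset size_mset_set)
  have "image_mset s (mset_set {1..card T}) = image_mset ((!) ?xs) (mset_set {0..<card T})"
  proof -
    have "mset_set {1..card T} = image_mset Suc (mset_set {0..<card T})"
      by (subst image_mset_mset_set) (auto simp: image_Suc_atLeastLessThan atLeastLessThanSuc_atLeastAtMost)
    then show ?thesis by (simp add: s_def multiset.map_comp comp_def)
  qed
  also have "\<dots> = mset (map ((!) ?xs) [0..<card T])" by simp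
  also have "\<dots> = mset ?xs" by (metis len map_nth)
  finally have 1: "lists_edge_lengths d T s" by (simp add: lists_edge_lengths_def)
  have "sorted ?xs" by simp
  then have "mono_on {1..card T} s"
    by (auto intro!: mono_onI sorted_nth_mono simp: s_def len)
  with 1 show ?thesis by (rule that)
qed

lemma xst_spectrum_ex:
  assumes "finite X" "X \<noteq> {}"
  shows "\<exists>s. xst_spectrum X d s"
proof -
  obtain a where a: "a \<in> X" using assms by blast
  have ne: "{T. tree_on X T} \<noteq> {}" using tree_on_star[OF a] by (metis empty_iff mem_Collect_eq)
  have "Max (tree_length d ` {T. tree_on X T}) \<in> tree_length d ` {T. tree_on X T}"
    using ne finite_trees[OF assms(1)] by (intro Max_in) auto
  then obtain T where "tree_on X T" "tree_length d T = Max (tree_length d ` {T. tree_on X T})"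
    by auto
  then have "maximum_spanning_tree X d T"
    using finite_trees[OF assms(1)] by (auto simp: maximum_spanning_tree_def)
  then show ?thesis unfolding xst_spectrum_def by (meson lists_edge_lengths_ex)
qed

lemma mst_spectrum_ex:
  assumes "finite X" "X \<noteq> {}"
  shows "\<exists>s. mst_spectrum X d s"
proof -
  obtain a where a: "a \<in> X" using assms by blast
  have ne: "{T. tree_on X T} \<noteq> {}" using tree_on_star[OF a] by (metis empty_iff mem_Collect_eq)
  have "Min (tree_length d ` {T. tree_on X T}) \<in> tree_length d ` {T. tree_on X T}"
    using ne finite_trees[OF assms(1)] by (intro Min_in) auto
  then obtain T where "tree_on X T" "tree_length d T = Min (tree_length d ` {T. tree_on X T})"
    by auto
  then have T: "minimum_spanning_tree X d T"
    using finite_trees[OF assms(1)] by (auto simp: minimum_spanning_tree_def)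
  obtain s where s: "lists_edge_lengths d T s" "mono_on {1..card T} s"
    by (rule lists_edge_lengths_ex)
  let ?t = "\<lambda>i. s (Suc (card T) - i)"
  have img: "(\<lambda>i. Suc (card T) - i) ` {1..card T} = {1..card T}"
  proof (intro equalityI subsetI)
    fix j assume "j \<in> {1..card T}"
    then have "j = Suc (card T) - (Suc (card T) - j)" "Suc (card T) - j \<in> {1..card T}" by auto
    then show "j \<in> (\<lambda>i. Suc (card T) - i) ` {1..card T}" by (rule image_eqI)
  qed auto
  have "inj_on (\<lambda>i. Suc (card T) - i) {1..card T}"
    by (auto simp: inj_on_def)
  then have "image_mset (\<lambda>i. Suc (card T) - i) (mset_set {1..card T}) = mset_set {1..card T}"
    by (simp only: image_mset_mset_set img)
  moreover have "image_mset ?t (mset_set {1..card T}) =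
      image_mset s (image_mset (\<lambda>i. Suc (card T) - i) (mset_set {1..card T}))"
    by (simp only: multiset.map_comp comp_def)
  ultimately have "lists_edge_lengths d T ?t"
    using s(1) unfolding lists_edge_lengths_def by (simp only:)
  moreover have "antimono_on {1..card T} ?t"
    by (rule monotone_onI) (auto intro!: mono_onD[OF s(2)])
  ultimately show ?thesis using T unfolding mst_spectrum_def by blast
qed

end

theory Submission
  imports Defs
begin

text \<open>
  A common ambient metric space in which the Hausdorff distance is less than \<open>r\<close> gives a
  correspondence, the pairs at distance less than \<open>r\<close>, of distortion at most \<open>2 r\<close>. Conversely, a
  correspondence of distortion \<open>\<delta> > 0\<close> lets one glue the two spaces so that corresponding points are
  at distance \<open>\<delta> / 2\<close>. So twice the Gromov--Hausdorff distance is the distortion of any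
  correspondence whose distortion is positive and minimal (\<open>GH_distance_eq_half_distortion\<close>), and it
  remains to show that the correspondence in question minimises the distortion and to compute it.

  Only three entries of the spectra matter. The exchange argument for trees gives their meaning:
  \<open>\<Sigma> (n - 1)\<close> is the largest distance, \<open>\<sigma> (n - 1)\<close> is the smallest distance between distinct points,
  attained at a closest pair \<open>{x, y}\<close>, and for \<open>n \<ge> 3\<close>, \<open>\<sigma> (n - 2)\<close> is the smallest distance over
  all pairs other than \<open>{x, y}\<close>. The last holds because a pair outside a minimum spanning tree closes a cycle with
  at least two edges of the tree that are at most as long as that pair.

  Each of the three terms bounds the distortion of any correspondence from below. Two points of \<open>X\<close>
  share a vertex, since there are fewer vertices than points; this gives \<open>\<sigma> (n - 1)\<close>. Two points at
  the largest distance correspond to vertices at distance at most \<open>l\<close>; this gives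
  \<open>\<Sigma> (n - 1) - l\<close>. And of any two pairs of points, not both can be collapsed to one vertex each
  without some point belonging to two vertices (\<open>simplex_distortion_ge_diff_two_pairs\<close>); this gives \<open>l - \<sigma> (n - 2)\<close>.
  The correspondence that merges \<open>x\<close> and \<open>y\<close> attains the maximum: it compares \<open>0\<close> with
  \<open>d x y = \<sigma> (n - 1)\<close>, and \<open>l\<close> with the distances of the other pairs, all of which lie between
  \<open>\<sigma> (n - 2)\<close> and \<open>\<Sigma> (n - 1)\<close>.
\<close>

section \<open>The Gromov--Hausdorff distance through correspondences\<close>

lemma distortion_upper:
  assumes "finite R" "(y, x) \<in> R" "(y', x') \<in> R"
  shows "\<bar>dY y y' - dX x x'\<bar> \<le> distortion dY dX R"
proof -
  have "{\<bar>dY y y' - dX x x'\<bar> | y x y' x'. (y, x) \<in> R \<and> (y', x') \<in> R}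
      = (\<lambda>(p, q). \<bar>dY (fst p) (fst q) - dX (snd p) (snd q)\<bar>) ` (R \<times> R)"
    by force
  then have "bdd_above {\<bar>dY y y' - dX x x'\<bar> | y x y' x'. (y, x) \<in> R \<and> (y', x') \<in> R}"
    using assms(1) by simp
  then show ?thesis
    unfolding distortion_def using assms(2,3) by (intro cSup_upper) blast+
qed

lemma distortion_least:
  assumes "R \<noteq> {}"
    and "\<And>y x y' x'. \<lbrakk>(y, x) \<in> R; (y', x') \<in> R\<rbrakk> \<Longrightarrow> \<bar>dY y y' - dX x x'\<bar> \<le> m"
  shows "distortion dY dX R \<le> m"
  unfolding distortion_def
proof (rule cSup_least)
  obtain y x where "(y, x) \<in> R" using assms(1) by auto
  then show "{\<bar>dY y y' - dX x x'\<bar> | y x y' x'. (y, x) \<in> R \<and> (y', x') \<in> R} \<noteq> {}" by blast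
qed (use assms(2) in blast)

lemma hausdorff_distance_ge:
  assumes "finite A" "finite B" "A \<noteq> {}" "B \<noteq> {}"
    and "\<And>r. \<lbrakk>0 < r; \<forall>a\<in>A. \<exists>b\<in>B. d a b < r; \<forall>b\<in>B. \<exists>a\<in>A. d a b < r\<rbrakk> \<Longrightarrow> m \<le> r"
  shows "m \<le> hausdorff_distance d A B"
  unfolding hausdorff_distance_def
proof (rule cInf_greatest)
  let ?r = "1 + Max (insert 0 ((\<lambda>(a, b). d a b) ` (A \<times> B)))"
  have "0 < ?r"
    using assms(1,2) by (intro add_pos_nonneg Max_ge) auto
  moreover have "d a b < ?r" if "a \<in> A" "b \<in> B" for a b
  proof -
    have "d a b \<le> Max (insert 0 ((\<lambda>(a, b). d a b) ` (A \<times> B)))"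
      using that assms(1,2) by (intro Max_ge) auto
    then show ?thesis by simp
  qed
  ultimately show "{r. 0 < r \<and> (\<forall>a\<in>A. \<exists>b\<in>B. d a b < r) \<and> (\<forall>b\<in>B. \<exists>a\<in>A. d a b < r)} \<noteq> {}"
    using assms(3,4) by blast
qed (use assms(5) in auto)

lemma hausdorff_distance_le:
  assumes "0 \<le> m" "\<And>a. a \<in> A \<Longrightarrow> \<exists>b\<in>B. d a b \<le> m" "\<And>b. b \<in> B \<Longrightarrow> \<exists>a\<in>A. d a b \<le> m"
  shows "hausdorff_distance d A B \<le> m"
proof (rule field_le_epsilon)
  fix e :: real
  assume "0 < e"
  then have "m < m + e" "0 < m + e" using assms(1) by auto
  then have "\<forall>a\<in>A. \<exists>b\<in>B. d a b < m + e" "\<forall>b\<in>B. \<exists>a\<in>A. d a b < m + e" "0 < m + e"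
    using assms(2,3) by (meson order_le_less_trans)+
  moreover have "bdd_below {r. 0 < r \<and> (\<forall>a\<in>A. \<exists>b\<in>B. d a b < r) \<and> (\<forall>b\<in>B. \<exists>a\<in>A. d a b < r)}"
    by (rule bdd_belowI[of _ 0]) simp
  ultimately show "hausdorff_distance d A B \<le> m + e"
    unfolding hausdorff_distance_def by (intro cInf_lower) auto
qed

text \<open>The length of the shortest way from \<open>y\<close> to \<open>x\<close> that changes spaces once, at no cost,
  at a pair of \<open>R\<close>.\<close>

definition link_dist ::
  "('b \<Rightarrow> 'b \<Rightarrow> real) \<Rightarrow> ('a \<Rightarrow> 'a \<Rightarrow> real) \<Rightarrow> ('b \<times> 'a) set \<Rightarrow> 'b \<Rightarrow> 'a \<Rightarrow> real" where
  "link_dist dY dX R y x = (INF q\<in>R. dY y (fst q) + dX (snd q) x)"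

text \<open>Changing spaces costs half of \<open>\<delta>\<close>. A detour through the other space then pays \<open>\<delta>\<close> for its
  two changes, so it is no shortcut as long as \<open>\<delta>\<close> bounds the distortion of \<open>R\<close>.\<close>

fun glued_dist :: "('b \<Rightarrow> 'b \<Rightarrow> real) \<Rightarrow> ('a \<Rightarrow> 'a \<Rightarrow> real) \<Rightarrow> ('b \<times> 'a) set \<Rightarrow> real \<Rightarrow>
    'b + 'a \<Rightarrow> 'b + 'a \<Rightarrow> real" where
  "glued_dist dY dX R \<delta> (Inl y) (Inl y') = dY y y'"
| "glued_dist dY dX R \<delta> (Inr x) (Inr x') = dX x x'"
| "glued_dist dY dX R \<delta> (Inl y) (Inr x) = \<delta> / 2 + link_dist dY dX R y x"
| "glued_dist dY dX R \<delta> (Inr x) (Inl y) = \<delta> / 2 + link_dist dY dX R y x"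

context
  fixes Y :: "'b set" and dY and X :: "'a set" and dX and R \<delta>
  assumes Y: "Metric_space Y dY" and X: "Metric_space X dX"
    and R: "R \<subseteq> Y \<times> X" "R \<noteq> {}"
    and dis: "\<And>y x y' x'. \<lbrakk>(y, x) \<in> R; (y', x') \<in> R\<rbrakk> \<Longrightarrow> \<bar>dY y y' - dX x x'\<bar> \<le> \<delta>"
begin

lemma link_dist_ge:
  assumes "\<And>a b. (a, b) \<in> R \<Longrightarrow> m \<le> dY y a + dX b x"
  shows "m \<le> link_dist dY dX R y x"
  unfolding link_dist_def using R(2) assms by (intro cINF_greatest) auto

lemma link_dist_le:
  assumes "(a, b) \<in> R"
  shows "link_dist dY dX R y x \<le> dY y a + dX b x"
proof -
  have "bdd_below ((\<lambda>q. dY y (fst q) + dX (snd q) x) ` R)"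
    using Metric_space.nonneg[OF Y] Metric_space.nonneg[OF X]
    by (intro bdd_belowI[of _ 0]) auto
  then show ?thesis
    using assms unfolding link_dist_def by (rule cINF_lower2) simp
qed

lemma link_dist_nonneg: "0 \<le> link_dist dY dX R y x"
  using Metric_space.nonneg[OF Y] Metric_space.nonneg[OF X] by (intro link_dist_ge) simp

lemma link_dist_step_left:
  assumes "y \<in> Y" "y' \<in> Y"
  shows "link_dist dY dX R y x \<le> dY y y' + link_dist dY dX R y' x"
proof -
  have "link_dist dY dX R y x - dY y y' \<le> dY y' a + dX b x" if "(a, b) \<in> R" for a b
    using link_dist_le[OF that, of y x] Metric_space.triangle[OF Y, of y y' a] assms that R(1)
    by auto
  then show ?thesis using link_dist_ge[of "link_dist dY dX R y x - dY y y'" y' x] by simp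
qed

lemma link_dist_step_right:
  assumes "x \<in> X" "x' \<in> X"
  shows "link_dist dY dX R y x' \<le> link_dist dY dX R y x + dX x x'"
proof -
  have "link_dist dY dX R y x' - dX x x' \<le> dY y a + dX b x" if "(a, b) \<in> R" for a b
    using link_dist_le[OF that, of y x'] Metric_space.triangle[OF X, of b x x'] assms that R(1)
    by auto
  then show ?thesis using link_dist_ge[of "link_dist dY dX R y x' - dX x x'" y x] by simp
qed

text \<open>Between two changes of space at \<open>(a, b)\<close> and \<open>(a', b')\<close>, a detour walks \<open>dX b b'\<close> instead of
  \<open>dY a a'\<close>, which saves at most \<open>\<delta>\<close>.\<close>

lemma link_dist_no_shortcut_left:
  assumes "y \<in> Y" "y' \<in> Y" "x \<in> X"
  shows "dY y y' \<le> \<delta> + link_dist dY dX R y x + link_dist dY dX R y' x"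
proof -
  have 1: "dY y y' - \<delta> - (dY y a + dX b x) \<le> dY y' a' + dX b' x"
    if "(a, b) \<in> R" "(a', b') \<in> R" for a b a' b'
  proof -
    have in_sp: "a \<in> Y" "a' \<in> Y" "b \<in> X" "b' \<in> X" using that R(1) by auto
    have "dY y y' \<le> dY y a + dY a a' + dY y' a'"
      using Metric_space.triangle[OF Y, of y a y'] Metric_space.triangle[OF Y, of a a' y']
        Metric_space.commute[OF Y, of a' y'] in_sp assms by simp
    moreover have "dX b b' \<le> dX b x + dX b' x"
      using Metric_space.triangle[OF X, of b x b'] Metric_space.commute[OF X, of x b'] in_sp assms
      by simp
    ultimately show ?thesis using dis[OF that] by linarith
  qed
  have "dY y y' - \<delta> - link_dist dY dX R y' x \<le> dY y a + dX b x" if "(a, b) \<in> R" for a b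
    using link_dist_ge[OF 1[OF that]] by linarith
  then show ?thesis
    using link_dist_ge[of "dY y y' - \<delta> - link_dist dY dX R y' x" y x] by simp
qed

lemma link_dist_no_shortcut_right:
  assumes "x \<in> X" "x' \<in> X" "y \<in> Y"
  shows "dX x x' \<le> \<delta> + link_dist dY dX R y x + link_dist dY dX R y x'"
proof -
  have 1: "dX x x' - \<delta> - (dY y a + dX b x) \<le> dY y a' + dX b' x'"
    if "(a, b) \<in> R" "(a', b') \<in> R" for a b a' b'
  proof -
    have in_sp: "a \<in> Y" "a' \<in> Y" "b \<in> X" "b' \<in> X" using that R(1) by auto
    have "dX x x' \<le> dX b x + dX b b' + dX b' x'"
      using Metric_space.triangle[OF X, of x b x'] Metric_space.triangle[OF X, of b b' x']
        Metric_space.commute[OF X, of b x] in_sp assms by simp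
    moreover have "dY a a' \<le> dY y a + dY y a'"
      using Metric_space.triangle[OF Y, of a y a'] Metric_space.commute[OF Y, of a y] in_sp assms
      by simp
    ultimately show ?thesis using dis[OF that] by linarith
  qed
  have "dX x x' - \<delta> - link_dist dY dX R y x' \<le> dY y a + dX b x" if "(a, b) \<in> R" for a b
    using link_dist_ge[OF 1[OF that]] by linarith
  then show ?thesis
    using link_dist_ge[of "dX x x' - \<delta> - link_dist dY dX R y x'" y x] by simp
qed

lemma Metric_space_glued_dist:
  assumes "0 < \<delta>"
  shows "Metric_space (Inl ` Y \<union> Inr ` X) (glued_dist dY dX R \<delta>)"
proof
  fix p q :: "'b + 'a"
  show "0 \<le> glued_dist dY dX R \<delta> p q"
    using assms link_dist_nonneg Metric_space.nonneg[OF Y] Metric_space.nonneg[OF X]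
    by (cases p; cases q) auto
  show "glued_dist dY dX R \<delta> p q = glued_dist dY dX R \<delta> q p"
    using Metric_space.commute[OF Y] Metric_space.commute[OF X] by (cases p; cases q) auto
next
  fix p q :: "'b + 'a"
  have "0 < \<delta> / 2 + link_dist dY dX R y x" for y x
    using assms link_dist_nonneg[of y x] by linarith
  then have "\<delta> / 2 + link_dist dY dX R y x \<noteq> 0" for y x
    by (metis less_irrefl)
  then show "glued_dist dY dX R \<delta> p q = 0 \<longleftrightarrow> p = q"
    if "p \<in> Inl ` Y \<union> Inr ` X" "q \<in> Inl ` Y \<union> Inr ` X"
    using that Metric_space.zero[OF Y] Metric_space.zero[OF X] by auto
next
  fix p q r :: "'b + 'a"
  note c = Metric_space.commute[OF Y] Metric_space.commute[OF X]
  assume "p \<in> Inl ` Y \<union> Inr ` X" "q \<in> Inl ` Y \<union> Inr ` X" "r \<in> Inl ` Y \<union> Inr ` X"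
  then show "glued_dist dY dX R \<delta> p r \<le> glued_dist dY dX R \<delta> p q + glued_dist dY dX R \<delta> q r"
    apply (elim UnE imageE)
           apply (simp_all add: Metric_space.triangle[OF Y] Metric_space.triangle[OF X])
    subgoal for y y' x using link_dist_step_left[of y y' x] by simp
    subgoal for y x y' using link_dist_no_shortcut_left[of y y' x] by simp
    subgoal for y x x' using link_dist_step_right[of x x' y] by simp
    subgoal for x y y' using link_dist_step_left[of y' y x] c(1)[of y y'] by simp
    subgoal for x y x' using link_dist_no_shortcut_right[of x x' y] by simp
    subgoal for x x' y using link_dist_step_right[of x' x y] c(2)[of x x'] by simp
    done
qed

end

lemma GH_distance_eq_half_distortion:
  fixes Y :: "'b set" and X :: "'a set"
  assumes Y: "Metric_space Y dY" "finite Y" "Y \<noteq> {}" and X: "Metric_space X dX" "finite X"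
    and R: "correspondence Y X R" and pos: "0 < distortion dY dX R"
    and min: "\<And>S. correspondence Y X S \<Longrightarrow> distortion dY dX R \<le> distortion dY dX S"
  shows "GH_distance Y dY X dX = 1 / 2 * distortion dY dX R"
proof -
  let ?\<delta> = "distortion dY dX R"
  let ?H = "{hausdorff_distance dZ (f ` Y) (g ` X) | (Z :: ('b + 'a) set) dZ f g.
    Metric_space Z dZ \<and> isometric_embedding Y dY Z dZ f \<and> isometric_embedding X dX Z dZ g}"
  have sub: "R \<subseteq> Y \<times> X" "fst ` R = Y" "snd ` R = X"
    using R by (auto simp: correspondence_def)
  have finR: "finite R" using sub(1) Y(2) X(2) by (meson finite_SigmaI finite_subset)
  have R_ne: "R \<noteq> {}" and X_ne: "X \<noteq> {}" using sub Y(3) by auto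
  have dis: "\<bar>dY y y' - dX x x'\<bar> \<le> ?\<delta>" if "(y, x) \<in> R" "(y', x') \<in> R" for y x y' x'
    using distortion_upper[OF finR that] .
  \<comment> \<open>In any common ambient space, the pairs at distance less than an admissible radius form a
    correspondence, whose distortion is at most twice that radius.\<close>
  have lower: "1 / 2 * ?\<delta> \<le> h" if h_in: "h \<in> ?H" for h
  proof -
    obtain Z :: "('b + 'a) set" and dZ f g where h: "h = hausdorff_distance dZ (f ` Y) (g ` X)"
      and Z: "Metric_space Z dZ" and f: "isometric_embedding Y dY Z dZ f"
      and g: "isometric_embedding X dX Z dZ g"
      using h_in by blast
    show ?thesis unfolding h
    proof (rule hausdorff_distance_ge)
      fix r :: real
      assume r: "\<forall>a\<in>f ` Y. \<exists>b\<in>g ` X. dZ a b < r" "\<forall>b\<in>g ` X. \<exists>a\<in>f ` Y. dZ a b < r"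
      define S where "S = {(y, x). y \<in> Y \<and> x \<in> X \<and> dZ (f y) (g x) < r}"
      have S: "correspondence Y X S"
        unfolding correspondence_def S_def using r by (force simp: image_iff)
      have "distortion dY dX S \<le> 2 * r"
      proof (rule distortion_least)
        show "S \<noteq> {}" using S Y(3) by (auto simp: correspondence_def)
      next
        fix y x y' x'
        assume "(y, x) \<in> S" "(y', x') \<in> S"
        then have yx: "y \<in> Y" "y' \<in> Y" "x \<in> X" "x' \<in> X"
          and near: "dZ (f y) (g x) < r" "dZ (f y') (g x') < r"
          by (auto simp: S_def)
        have in_Z: "f y \<in> Z" "f y' \<in> Z" "g x \<in> Z" "g x' \<in> Z"
          using yx f g by (auto simp: isometric_embedding_def)
        have "dZ (f y) (f y') \<le> dZ (f y) (g x) + dZ (g x) (g x') + dZ (f y') (g x')"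
          using Metric_space.triangle[OF Z, of "f y" "g x" "f y'"]
            Metric_space.triangle[OF Z, of "g x" "g x'" "f y'"]
            Metric_space.commute[OF Z, of "g x'" "f y'"] in_Z by simp
        moreover have "dZ (g x) (g x') \<le> dZ (f y) (g x) + dZ (f y) (f y') + dZ (f y') (g x')"
          using Metric_space.triangle[OF Z, of "g x" "f y" "g x'"]
            Metric_space.triangle[OF Z, of "f y" "f y'" "g x'"]
            Metric_space.commute[OF Z, of "g x" "f y"] in_Z by simp
        moreover have "dZ (f y) (f y') = dY y y'" "dZ (g x) (g x') = dX x x'"
          using yx f g by (auto simp: isometric_embedding_def)
        ultimately show "\<bar>dY y y' - dX x x'\<bar> \<le> 2 * r" using near by linarith
      qed
      then show "1 / 2 * ?\<delta> \<le> r" using min[OF S] by linarith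
    qed (use Y X X_ne in auto)
  qed
  let ?d = "glued_dist dY dX R ?\<delta>"
  have glued: "hausdorff_distance ?d (Inl ` Y) (Inr ` X) \<in> ?H"
  proof -
    have "isometric_embedding Y dY (Inl ` Y \<union> Inr ` X) ?d Inl"
      "isometric_embedding X dX (Inl ` Y \<union> Inr ` X) ?d Inr"
      by (auto simp: isometric_embedding_def)
    then show ?thesis
      using Metric_space_glued_dist[OF Y(1) X(1) sub(1) R_ne dis pos] by blast
  qed
  have "link_dist dY dX R y x \<le> 0" if "(y, x) \<in> R" for y x
    using link_dist_le[OF Y(1) X(1) sub(1) R_ne dis that, of y x] that sub(1)
      Metric_space.mdist_zero[OF Y(1), of y] Metric_space.mdist_zero[OF X(1), of x] by auto
  then have near: "?d (Inl y) (Inr x) \<le> ?\<delta> / 2" if "(y, x) \<in> R" for y x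
    using that by simp
  have "hausdorff_distance ?d (Inl ` Y) (Inr ` X) \<le> 1 / 2 * ?\<delta>"
  proof (rule hausdorff_distance_le)
    fix a assume "a \<in> (Inl ` Y :: ('b + 'a) set)"
    then obtain y x where "a = Inl y" "(y, x) \<in> R" using sub(2) by force
    then show "\<exists>b\<in>Inr ` X. ?d a b \<le> 1 / 2 * ?\<delta>" using near[of y x] sub(1) by auto
  next
    fix b assume "b \<in> (Inr ` X :: ('b + 'a) set)"
    then obtain y x where "b = Inr x" "(y, x) \<in> R" using sub(3) by force
    then show "\<exists>a\<in>Inl ` Y. ?d a b \<le> 1 / 2 * ?\<delta>" using near[of y x] sub(1) by auto
  qed (use pos in simp)
  moreover have "GH_distance Y dY X dX = Inf ?H" by (simp only: GH_distance_def)
  moreover have "Inf ?H \<le> hausdorff_distance ?d (Inl ` Y) (Inr ` X)"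
    using glued lower by (intro cInf_lower bdd_belowI[of _ "1 / 2 * ?\<delta>"])
  moreover have "1 / 2 * ?\<delta> \<le> Inf ?H" using glued lower by (intro cInf_greatest) blast+
  ultimately show ?thesis by linarith
qed

section \<open>Trees on a finite set\<close>

definition edges_on :: "'a set \<Rightarrow> 'a set set \<Rightarrow> bool" where
  "edges_on X T \<longleftrightarrow> T \<subseteq> {{x, y} | x y. x \<in> X \<and> y \<in> X \<and> x \<noteq> y}"

definition connects :: "'a set \<Rightarrow> 'a set set \<Rightarrow> bool" where
  "connects X T \<longleftrightarrow> (\<forall>x\<in>X. \<forall>y\<in>X. (x, y) \<in> {(u, v). {u, v} \<in> T}\<^sup>*)"

lemma tree_on_iff: "tree_on X T \<longleftrightarrow> edges_on X T \<and> connects X T \<and> \<not> (\<exists>c. graph_cycle T c)"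
  by (simp add: tree_on_def edges_on_def connects_def)

lemma edges_onD:
  assumes "edges_on X T" "{x, y} \<in> T"
  shows "x \<in> X" "y \<in> X" "x \<noteq> y"
  using assms by (auto simp: edges_on_def doubleton_eq_iff dest!: subsetD)

lemma finite_edges_on: "\<lbrakk>finite X; edges_on X T\<rbrakk> \<Longrightarrow> finite T"
  by (rule finite_subset[of _ "Pow X"]) (auto simp: edges_on_def)

lemma edge_rtrancl_sym:
  "(x, y) \<in> {(u, v). {u, v} \<in> T}\<^sup>* \<Longrightarrow> (y, x) \<in> {(u, v). {u, v} \<in> T}\<^sup>*"
  by (rule symD[OF sym_rtrancl]) (auto simp: sym_def insert_commute)

text \<open>Descending along \<open>h\<close>, every vertex reaches \<open>r\<close>. This avoids all talk of paths when edges of a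
  rooted tree are exchanged.\<close>

lemma connects_if_descent:
  fixes h :: "'a \<Rightarrow> nat"
  assumes step: "\<And>x. \<lbrakk>x \<in> X; x \<noteq> r\<rbrakk> \<Longrightarrow> \<exists>y\<in>X. {x, y} \<in> T \<and> h y < h x"
  shows "connects X T"
proof -
  let ?E = "{(u, v). {u, v} \<in> T}"
  have root: "(x, r) \<in> ?E\<^sup>*" if "x \<in> X" for x
    using that
  proof (induction "h x" arbitrary: x rule: less_induct)
    case less
    show ?case
    proof (cases "x = r")
      case False
      then obtain y where y: "y \<in> X" "{x, y} \<in> T" "h y < h x"
        using step less.prems by blast
      then have "(y, r) \<in> ?E\<^sup>*" using less.hyps by blast
      with y(2) show ?thesis by (auto intro: converse_rtrancl_into_rtrancl)
    qed simp
  qed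
  show ?thesis
    unfolding connects_def using rtrancl_trans[OF root edge_rtrancl_sym[OF root]] by (intro ballI)
qed

definition parent_map :: "'a set \<Rightarrow> 'a set set \<Rightarrow> 'a \<Rightarrow> ('a \<Rightarrow> 'a) \<Rightarrow> ('a \<Rightarrow> nat) \<Rightarrow> bool" where
  "parent_map X T r p h \<longleftrightarrow>
     h r = 0 \<and> (\<forall>x\<in>X. x \<noteq> r \<longrightarrow> p x \<in> X \<and> {x, p x} \<in> T \<and> h x = Suc (h (p x)))"

text \<open>The height is the number of edges to the root, and the parent of a vertex is the next vertex
  on a shortest path to the root.\<close>

lemma connects_obtain_parent_map:
  assumes "edges_on X T" "connects X T" "r \<in> X"
  obtains p h where "parent_map X T r p h"
proof -
  let ?E = "{(u, v). {u, v} \<in> T}"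
  define h where "h x = (LEAST k. (x, r) \<in> ?E ^^ k)" for x
  have h_path: "(x, r) \<in> ?E ^^ h x" if "x \<in> X" for x
  proof -
    have "\<exists>k. (x, r) \<in> ?E ^^ k"
      using assms(2,3) that unfolding connects_def by (meson rtrancl_imp_relpow)
    then show ?thesis unfolding h_def by (rule LeastI_ex)
  qed
  have h_le: "h x \<le> k" if "(x, r) \<in> ?E ^^ k" for x k
    unfolding h_def using that by (rule Least_le)
  have "\<exists>y. y \<in> X \<and> {x, y} \<in> T \<and> h x = Suc (h y)" if x: "x \<in> X" "x \<noteq> r" for x
  proof -
    obtain m where m: "h x = Suc m"
      using h_path[OF x(1)] x(2) by (cases "h x") auto
    then obtain y where y: "{x, y} \<in> T" "(y, r) \<in> ?E ^^ m"
      using h_path[OF x(1)] relpow_Suc_D2[of x r m ?E] by auto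
    have "y \<in> X" using edges_onD[OF assms(1) y(1)] by simp
    then have "(x, r) \<in> ?E ^^ Suc (h y)"
      using y(1) h_path by (intro relpow_Suc_I2) auto
    then have "h x = Suc (h y)" using h_le[of x "Suc (h y)"] h_le[OF y(2)] m by simp
    with y(1) \<open>y \<in> X\<close> show ?thesis by blast
  qed
  then obtain p where "\<And>x. \<lbrakk>x \<in> X; x \<noteq> r\<rbrakk> \<Longrightarrow> p x \<in> X \<and> {x, p x} \<in> T \<and> h x = Suc (h (p x))"
    by metis
  moreover have "h r = 0" using h_le[of r 0] by simp
  ultimately have "parent_map X T r p h" unfolding parent_map_def by blast
  then show ?thesis by (rule that)
qed

text \<open>Two vertices with the same parent edge would be parents of each other, each higher than the
  other.\<close>

lemma parent_edge_inj:
  fixes h :: "'a \<Rightarrow> nat"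
  assumes "h x = Suc (h (p x))" "h y = Suc (h (p y))" "{x, p x} = {y, p y}"
  shows "x = y"
  using assms by (auto simp: doubleton_eq_iff)

lemma connects_obtain_subtree:
  assumes "finite X" "X \<noteq> {}" "edges_on X T" "connects X T"
  obtains P where "P \<subseteq> T" "connects X P" "card P = card X - 1"
proof -
  obtain r where r: "r \<in> X" using assms(2) by blast
  obtain p h where "parent_map X T r p h"
    by (rule connects_obtain_parent_map[OF assms(3,4) r])
  then have p: "p x \<in> X \<and> {x, p x} \<in> T \<and> h x = Suc (h (p x))" if "x \<in> X" "x \<noteq> r" for x
    using that unfolding parent_map_def by blast
  let ?P = "(\<lambda>x. {x, p x}) ` (X - {r})"
  have "inj_on (\<lambda>x. {x, p x}) (X - {r})"
  proof (rule inj_onI)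
    fix x y assume "x \<in> X - {r}" "y \<in> X - {r}" and eq: "{x, p x} = {y, p y}"
    then have "h x = Suc (h (p x))" "h y = Suc (h (p y))" using p by blast+
    then show "x = y" using eq by (rule parent_edge_inj)
  qed
  then have card: "card ?P = card X - 1"
    using r by (simp add: card_image)
  have conn: "connects X ?P"
  proof (rule connects_if_descent)
    fix x assume "x \<in> X" "x \<noteq> r"
    then show "\<exists>y\<in>X. {x, y} \<in> ?P \<and> h y < h x"
      using p[of x] by (intro bexI[of _ "p x"]) auto
  qed
  have "?P \<subseteq> T" by (rule image_subsetI) (use p in blast)
  then show ?thesis using conn card by (rule that)
qed

lemma rtrancl_obtain_simple_path:
  assumes "(a, b) \<in> E\<^sup>*"
  obtains c where "c \<noteq> []" "hd c = a" "last c = b" "distinct c" "successively (\<lambda>x y. (x, y) \<in> E) c"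
proof -
  have "\<exists>c. c \<noteq> [] \<and> hd c = a \<and> last c = b \<and> distinct c \<and> successively (\<lambda>x y. (x, y) \<in> E) c"
    using assms
  proof (induction rule: converse_rtrancl_induct)
    case base
    show ?case by (rule exI[of _ "[b]"]) simp
  next
    case (step a a')
    then obtain c where c: "c \<noteq> []" "hd c = a'" "last c = b" "distinct c"
      "successively (\<lambda>x y. (x, y) \<in> E) c"
      by blast
    show ?case
    proof (cases "a \<in> set c")
      case True
      then obtain us vs where "c = us @ a # vs" by (meson split_list)
      with c show ?thesis
        by (intro exI[of _ "a # vs"]) (auto simp: successively_append_iff)
    next
      case False
      with c step.hyps(1) show ?thesis
        by (intro exI[of _ "a # c"]) (cases c; auto)
    qed
  qed
  with that show ?thesis by blast
qed

text \<open>An edge outside a connecting subset closes a cycle with a simple path between its ends, so a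
  tree is its own connecting subset.\<close>

lemma tree_on_card:
  assumes "finite X" "X \<noteq> {}" "tree_on X T"
  shows "card T = card X - 1"
proof -
  have T: "edges_on X T" "connects X T" and acyclic: "\<not> (\<exists>c. graph_cycle T c)"
    using assms(3) by (auto simp: tree_on_iff)
  obtain P where P: "P \<subseteq> T" "connects X P" "card P = card X - 1"
    using connects_obtain_subtree[OF assms(1,2) T] .
  have "e \<in> P" if e: "e \<in> T" for e
  proof (rule ccontr)
    assume "e \<notin> P"
    obtain a b where ab: "e = {a, b}" "a \<in> X" "b \<in> X" "a \<noteq> b"
      using T(1) e by (auto simp: edges_on_def)
    have "(a, b) \<in> {(u, v). {u, v} \<in> P}\<^sup>*"
      using P(2) ab by (simp add: connects_def)
    then obtain c where c: "c \<noteq> []" "hd c = a" "last c = b" "distinct c"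
      "successively (\<lambda>x y. (x, y) \<in> {(u, v). {u, v} \<in> P}) c"
      by (rule rtrancl_obtain_simple_path)
    have step: "{c ! i, c ! Suc i} \<in> P" if "Suc i < length c" for i
      using c(5) that by (simp add: successively_conv_nth)
    have ends: "c ! 0 = a" "c ! (length c - 1) = b"
      using c(1-3) by (auto simp: hd_conv_nth last_conv_nth)
    have "length c \<noteq> 0" "length c \<noteq> 1" "length c \<noteq> 2"
      using ends step[of 0] ab(1,4) c(1) \<open>e \<notin> P\<close> by auto
    then have "3 \<le> length c" by linarith
    moreover have "{c ! i, c ! (Suc i mod length c)} \<in> T" if "i < length c" for i
    proof (cases "Suc i < length c")
      case True
      with step P(1) show ?thesis by auto
    next
      case False
      with that have "i = length c - 1" "Suc i = length c" by auto
      then show ?thesis using ends e ab(1) by (simp add: insert_commute)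
    qed
    ultimately have "graph_cycle T c" using c(4) by (simp add: graph_cycle_def)
    with acyclic show False by blast
  qed
  then show ?thesis using P(1,3) by (metis subset_antisym subsetI)
qed

text \<open>An edge of a cycle can be removed without disconnecting \<open>X\<close>, and then too few edges are left
  for \<open>X\<close> to be connected.\<close>

lemma tree_onI_card:
  assumes "finite X" "X \<noteq> {}" "edges_on X T" "connects X T" and card: "card T \<le> card X - 1"
  shows "tree_on X T"
proof -
  have "False" if "graph_cycle T c" for c
  proof -
    let ?k = "length c"
    have k: "3 \<le> ?k" and dis: "distinct c"
      and edge: "\<And>i. i < ?k \<Longrightarrow> {c ! i, c ! (Suc i mod ?k)} \<in> T"
      using that by (auto simp: graph_cycle_def)
    define e where "e = {c ! (?k - 1), c ! 0}"
    have "Suc (?k - 1) mod ?k = 0" using k by (cases ?k) auto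
    then have eT: "e \<in> T" using edge[of "?k - 1"] k by (simp add: e_def)
    let ?E = "{(u, v). {u, v} \<in> T}" and ?E' = "{(u, v). {u, v} \<in> T - {e}}"
    have along: "(c ! 0, c ! i) \<in> ?E'\<^sup>*" if "i < ?k" for i
      using that
    proof (induction i)
      case (Suc i)
      have "{c ! i, c ! Suc i} \<in> T" using edge[of i] Suc.prems by simp
      moreover have "{c ! i, c ! Suc i} \<noteq> e"
      proof
        assume "{c ! i, c ! Suc i} = e"
        then have "i = ?k - 1 \<and> Suc i = 0 \<or> i = 0 \<and> Suc i = ?k - 1"
          using nth_eq_iff_index_eq[OF dis, of i "?k - 1"] nth_eq_iff_index_eq[OF dis, of i 0]
            nth_eq_iff_index_eq[OF dis, of "Suc i" "?k - 1"] nth_eq_iff_index_eq[OF dis, of "Suc i" 0]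
            Suc.prems
          unfolding e_def doubleton_eq_iff by linarith
        then show False using k by auto
      qed
      ultimately have "(c ! i, c ! Suc i) \<in> ?E'" by simp
      with Suc show ?case by (meson Suc_lessD rtrancl.rtrancl_into_rtrancl)
    qed simp
    have ends: "(c ! 0, c ! (?k - 1)) \<in> ?E'\<^sup>*" using along[of "?k - 1"] k by simp
    have "(u, v) \<in> ?E'\<^sup>*" if "(u, v) \<in> ?E" for u v
    proof (cases "{u, v} = e")
      case True
      then show ?thesis
        using ends edge_rtrancl_sym[OF ends] by (auto simp: e_def doubleton_eq_iff)
    qed (use that in auto)
    then have "?E \<subseteq> ?E'\<^sup>*" by auto
    then have "?E\<^sup>* \<subseteq> ?E'\<^sup>*" by (rule rtrancl_subset_rtrancl)
    then have "connects X (T - {e})" using assms(4) unfolding connects_def by blast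
    moreover have "edges_on X (T - {e})" using assms(3) by (auto simp: edges_on_def)
    ultimately obtain P where P: "P \<subseteq> T - {e}" "card P = card X - 1"
      using connects_obtain_subtree[OF assms(1,2)] by metis
    have finT: "finite T" using assms(1,3) by (rule finite_edges_on)
    then have "card P < card T"
      using P(1) eT by (intro psubset_card_mono) auto
    then show False using P(2) card by simp
  qed
  then show ?thesis using assms(3,4) by (auto simp: tree_on_iff)
qed

text \<open>Root the tree at \<open>v\<close> and replace the edge from \<open>u\<close> to its parent by the edge \<open>{u, v}\<close>: every
  vertex still has a neighbour of smaller height, and the number of edges does not grow.\<close>

lemma tree_on_exchange:
  assumes "finite X" "tree_on X T" "u \<in> X" "v \<in> X" "u \<noteq> v"
  obtains w where "{u, w} \<in> T" "tree_on X (insert {u, v} (T - {{u, w}}))"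
proof -
  have T: "edges_on X T" "connects X T" using assms(2) by (auto simp: tree_on_iff)
  obtain p h where "parent_map X T v p h"
    by (rule connects_obtain_parent_map[OF T assms(4)])
  then have h: "h v = 0"
    and p: "\<And>x. \<lbrakk>x \<in> X; x \<noteq> v\<rbrakk> \<Longrightarrow> p x \<in> X \<and> {x, p x} \<in> T \<and> h x = Suc (h (p x))"
    unfolding parent_map_def by blast+
  let ?T = "insert {u, v} (T - {{u, p u}})"
  have finT: "finite T" using assms(1) T(1) by (rule finite_edges_on)
  have uT: "{u, p u} \<in> T" using p[OF assms(3,5)] by blast
  have "connects X ?T"
  proof (rule connects_if_descent)
    fix x assume x: "x \<in> X" "x \<noteq> v"
    show "\<exists>y\<in>X. {x, y} \<in> ?T \<and> h y < h x"
    proof (cases "x = u")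
      case True
      have "h v < h x" using h p[OF x] by simp
      then show ?thesis using True assms(4) by (intro bexI[of _ v]) auto
    next
      case False
      have "h x = Suc (h (p x))" "h u = Suc (h (p u))" using p[OF x] p[OF assms(3,5)] by auto
      with False have "{x, p x} \<noteq> {u, p u}" using parent_edge_inj[of h x p u] by blast
      then show ?thesis using p[OF x] by (intro bexI[of _ "p x"]) auto
    qed
  qed
  moreover have "edges_on X ?T" using T(1) assms by (auto simp: edges_on_def)
  moreover have "card ?T \<le> card X - 1"
  proof -
    have "card ?T \<le> Suc (card (T - {{u, p u}}))" by (rule card_insert_le_m1) auto
    also have "\<dots> = card T" using finT uT by (simp only: card_Suc_Diff1)
    finally show ?thesis using tree_on_card[OF assms(1) _ assms(2)] assms(3) by fastforce
  qed
  ultimately have "tree_on X ?T" using assms(1,3) by (intro tree_onI_card) auto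
  with uT show ?thesis using that by blast
qed

text \<open>The exchange at \<open>u\<close> and the exchange at \<open>v\<close> remove the two neighbours of \<open>{u, v}\<close> in the cycle
  that it closes. They differ, since a common edge would have to be \<open>{u, v}\<close> itself.\<close>

lemma tree_on_two_exchanges:
  assumes "finite X" "tree_on X T" "u \<in> X" "v \<in> X" "u \<noteq> v" "{u, v} \<notin> T"
  obtains e e' where "e \<in> T" "e' \<in> T" "e \<noteq> e'"
    "tree_on X (insert {u, v} (T - {e}))" "tree_on X (insert {u, v} (T - {e'}))"
proof -
  obtain w where w: "{u, w} \<in> T" "tree_on X (insert {u, v} (T - {{u, w}}))"
    using tree_on_exchange assms(1-5) by metis
  obtain w' where w': "{v, w'} \<in> T" "tree_on X (insert {u, v} (T - {{v, w'}}))"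
    using tree_on_exchange[of X T v u] assms(1-5) by (metis insert_commute)
  have "{u, w} \<noteq> {v, w'}"
    using w(1) assms(5,6) by (auto simp: doubleton_eq_iff)
  with w w' that show ?thesis by blast
qed

lemma tree_length_exchange:
  assumes "finite T" "e \<in> T" "f \<notin> T"
  shows "tree_length d (insert f (T - {e})) = tree_length d T - edge_length d e + edge_length d f"
  using assms by (simp add: tree_length_def sum_diff1)

section \<open>The extreme entries of the spectra\<close>

text \<open>Statements about single entries of a spectrum are translated into counts of tree edges, which
  spares an explicit bijection between indices and edges.\<close>

lemma lists_edge_lengths_card:
  assumes "finite T" "lists_edge_lengths d T s"
  shows "card {i \<in> {1..card T}. P (s i)} = card {e \<in> T. P (edge_length d e)}"
proof -
  have "size (filter_mset P (image_mset s (mset_set {1..card T})))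
      = size (filter_mset P (image_mset (edge_length d) (mset_set T)))"
    using assms(2) by (simp add: lists_edge_lengths_def)
  then show ?thesis using assms(1) by (simp add: filter_mset_image_mset)
qed

lemma lists_edge_lengths_in:
  assumes "finite T" "lists_edge_lengths d T s" "i \<in> {1..card T}"
  obtains e where "e \<in> T" "edge_length d e = s i"
proof -
  have "s i \<in># image_mset s (mset_set {1..card T})" using assms(3) by simp
  then have "s i \<in># image_mset (edge_length d) (mset_set T)"
    using assms(2) by (simp only: lists_edge_lengths_def)
  then have "s i \<in> edge_length d ` T" using assms(1) by simp
  with that show ?thesis by auto
qed

lemma lists_edge_lengths_ex_index:
  assumes "finite T" "lists_edge_lengths d T s" "e \<in> T"
  obtains i where "i \<in> {1..card T}" "s i = edge_length d e"
proof -
  have "edge_length d e \<in># image_mset s (mset_set {1..card T})"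
    using assms by (simp add: lists_edge_lengths_def)
  with that show ?thesis by auto
qed

context
  fixes X :: "'a set" and d :: "'a \<Rightarrow> 'a \<Rightarrow> real"
  assumes X: "finite X" and sym: "\<And>x y. d x y = d y x"
begin

lemma minimum_spanning_tree_two_shorter_edges:
  assumes "minimum_spanning_tree X d T" "u \<in> X" "v \<in> X" "u \<noteq> v" "{u, v} \<notin> T"
  obtains e e' where "e \<in> T" "e' \<in> T" "e \<noteq> e'"
    "edge_length d e \<le> d u v" "edge_length d e' \<le> d u v"
proof -
  have T: "tree_on X T" and min: "\<And>T'. tree_on X T' \<Longrightarrow> tree_length d T \<le> tree_length d T'"
    using assms(1) by (auto simp: minimum_spanning_tree_def)
  have finT: "finite T" using finite_edges_on[OF X] T by (simp add: tree_on_iff)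
  have "edge_length d e \<le> d u v" if "e \<in> T" "tree_on X (insert {u, v} (T - {e}))" for e
    using min[OF that(2)] tree_length_exchange[OF finT that(1) assms(5), of d]
      edge_length_pair[of d u v, OF sym] by linarith
  with tree_on_two_exchanges[OF X T assms(2-5)] that show ?thesis by metis
qed

lemma maximum_spanning_tree_longer_edge:
  assumes "maximum_spanning_tree X d T" "u \<in> X" "v \<in> X" "u \<noteq> v"
  obtains e where "e \<in> T" "d u v \<le> edge_length d e"
proof (cases "{u, v} \<in> T")
  case True
  then show ?thesis using that edge_length_pair[of d u v, OF sym] by (metis order_refl)
next
  case False
  have T: "tree_on X T" and max: "\<And>T'. tree_on X T' \<Longrightarrow> tree_length d T' \<le> tree_length d T"
    using assms(1) by (auto simp: maximum_spanning_tree_def)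
  have finT: "finite T" using finite_edges_on[OF X] T by (simp add: tree_on_iff)
  obtain w where w: "{u, w} \<in> T" "tree_on X (insert {u, v} (T - {{u, w}}))"
    using tree_on_exchange[OF X T assms(2-4)] by blast
  show ?thesis
    using that[OF w(1)] max[OF w(2)] tree_length_exchange[OF finT w(1) False, of d]
      edge_length_pair[of d u v, OF sym] by linarith
qed

lemma tree_edgeE:
  assumes "tree_on X T" "e \<in> T"
  obtains u v where "e = {u, v}" "u \<in> X" "v \<in> X" "u \<noteq> v" "edge_length d e = d u v"
proof -
  obtain u v where "e = {u, v}" "u \<in> X" "v \<in> X" "u \<noteq> v"
    using assms by (auto simp: tree_on_def)
  with that edge_length_pair[of d u v, OF sym] show ?thesis by blast
qed

lemma xst_spectrum_last:
  assumes "xst_spectrum X d \<Sigma>" "2 \<le> card X"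
  shows "\<exists>u\<in>X. \<exists>v\<in>X. u \<noteq> v \<and> d u v = \<Sigma> (card X - 1)"
    and "\<And>u v. \<lbrakk>u \<in> X; v \<in> X; u \<noteq> v\<rbrakk> \<Longrightarrow> d u v \<le> \<Sigma> (card X - 1)"
proof -
  obtain T where max: "maximum_spanning_tree X d T" and s: "lists_edge_lengths d T \<Sigma>"
    and mono: "mono_on {1..card T} \<Sigma>"
    using assms(1) by (auto simp: xst_spectrum_def)
  have T: "tree_on X T" using max by (simp add: maximum_spanning_tree_def)
  have finT: "finite T" using finite_edges_on[OF X] T by (simp add: tree_on_iff)
  have card: "card T = card X - 1" using tree_on_card[OF X _ T] assms(2) by fastforce
  have last: "card T \<in> {1..card T}" using card assms(2) by simp
  obtain e where "e \<in> T" "edge_length d e = \<Sigma> (card T)"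
    using lists_edge_lengths_in[OF finT s last] .
  then show "\<exists>u\<in>X. \<exists>v\<in>X. u \<noteq> v \<and> d u v = \<Sigma> (card X - 1)"
    using tree_edgeE[OF T] card by metis
  fix u v assume uv: "u \<in> X" "v \<in> X" "u \<noteq> v"
  then obtain e where e: "e \<in> T" "d u v \<le> edge_length d e"
    using maximum_spanning_tree_longer_edge[OF max] by blast
  obtain i where i: "i \<in> {1..card T}" "\<Sigma> i = edge_length d e"
    using lists_edge_lengths_ex_index[OF finT s e(1)] by blast
  have "\<Sigma> i \<le> \<Sigma> (card T)" using i(1) by (intro mono_onD[OF mono]) auto
  then show "d u v \<le> \<Sigma> (card X - 1)" using e i card by simp
qed

lemma mst_spectrum_last:
  assumes "mst_spectrum X d \<sigma>" "2 \<le> card X"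
  shows "\<exists>u\<in>X. \<exists>v\<in>X. u \<noteq> v \<and> d u v = \<sigma> (card X - 1)"
    and "\<And>u v. \<lbrakk>u \<in> X; v \<in> X; u \<noteq> v\<rbrakk> \<Longrightarrow> \<sigma> (card X - 1) \<le> d u v"
proof -
  obtain T where min: "minimum_spanning_tree X d T" and s: "lists_edge_lengths d T \<sigma>"
    and anti: "antimono_on {1..card T} \<sigma>"
    using assms(1) by (auto simp: mst_spectrum_def)
  have T: "tree_on X T" using min by (simp add: minimum_spanning_tree_def)
  have finT: "finite T" using finite_edges_on[OF X] T by (simp add: tree_on_iff)
  have card: "card T = card X - 1" using tree_on_card[OF X _ T] assms(2) by fastforce
  have last: "card T \<in> {1..card T}" using card assms(2) by simp
  obtain e where "e \<in> T" "edge_length d e = \<sigma> (card T)"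
    using lists_edge_lengths_in[OF finT s last] .
  then show "\<exists>u\<in>X. \<exists>v\<in>X. u \<noteq> v \<and> d u v = \<sigma> (card X - 1)"
    using tree_edgeE[OF T] card by metis
  fix u v assume uv: "u \<in> X" "v \<in> X" "u \<noteq> v"
  obtain e where e: "e \<in> T" "edge_length d e \<le> d u v"
  proof (cases "{u, v} \<in> T")
    case True
    then show ?thesis using that edge_length_pair[of d u v, OF sym] by (metis order_refl)
  next
    case False
    then show ?thesis using minimum_spanning_tree_two_shorter_edges[OF min uv] that by metis
  qed
  obtain i where i: "i \<in> {1..card T}" "\<sigma> i = edge_length d e"
    using lists_edge_lengths_ex_index[OF finT s e(1)] by blast
  have "\<sigma> (card T) \<le> \<sigma> i" using i(1) by (intro monotone_onD[OF anti]) auto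
  then show "\<sigma> (card X - 1) \<le> d u v" using e i card by simp
qed

text \<open>At least two tree edges have length at most \<open>\<sigma> (card X - 2)\<close>, so one of them is not \<open>{x, y}\<close>.
  At most one tree edge is shorter than \<open>\<sigma> (card X - 2)\<close>; hence a pair that is shorter belongs to
  the tree, as otherwise it would bring two such edges, and there is only one such pair. If some
  pair other than the closest pair \<open>{x, y}\<close> were shorter, then \<open>{x, y}\<close> would be a second one.\<close>

lemma mst_spectrum_second_last:
  assumes "mst_spectrum X d \<sigma>" "3 \<le> card X"
    and xy: "x \<in> X" "y \<in> X" "x \<noteq> y"
  shows "\<exists>u\<in>X. \<exists>v\<in>X. u \<noteq> v \<and> {u, v} \<noteq> {x, y} \<and> d u v \<le> \<sigma> (card X - 2)"
    and "\<And>u v. \<lbrakk>\<And>a b. \<lbrakk>a \<in> X; b \<in> X; a \<noteq> b\<rbrakk> \<Longrightarrow> d x y \<le> d a b; u \<in> X; v \<in> X; u \<noteq> v; {u, v} \<noteq> {x, y}\<rbrakk>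
      \<Longrightarrow> \<sigma> (card X - 2) \<le> d u v"
proof -
  obtain T where min: "minimum_spanning_tree X d T" and s: "lists_edge_lengths d T \<sigma>"
    and anti: "antimono_on {1..card T} \<sigma>"
    using assms(1) by (auto simp: mst_spectrum_def)
  have T: "tree_on X T" using min by (simp add: minimum_spanning_tree_def)
  have finT: "finite T" using finite_edges_on[OF X] T by (simp add: tree_on_iff)
  have card: "card T = card X - 1" using tree_on_card[OF X _ T] assms(2) by fastforce
  let ?k = "card X - 2"
  have k: "?k \<in> {1..card T}" "Suc ?k = card T" "card T \<in> {1..card T}" using card assms(2) by auto
  have "\<sigma> (card T) \<le> \<sigma> ?k" using k by (intro monotone_onD[OF anti]) auto
  then have "card {?k, card T} \<le> card {i \<in> {1..card T}. \<sigma> i \<le> \<sigma> ?k}"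
    using k by (intro card_mono) auto
  then have "2 \<le> card {e \<in> T. edge_length d e \<le> \<sigma> ?k}"
    using lists_edge_lengths_card[OF finT s, of "\<lambda>t. t \<le> \<sigma> ?k"] k(2) by auto
  then have "\<not> {e \<in> T. edge_length d e \<le> \<sigma> ?k} \<subseteq> {{x, y}}"
    using card_mono[of "{{x, y}}" "{e \<in> T. edge_length d e \<le> \<sigma> ?k}"] by auto
  then obtain e where "e \<in> T" "edge_length d e \<le> \<sigma> ?k" "e \<noteq> {x, y}" by blast
  then show "\<exists>u\<in>X. \<exists>v\<in>X. u \<noteq> v \<and> {u, v} \<noteq> {x, y} \<and> d u v \<le> \<sigma> (card X - 2)"
    using tree_edgeE[OF T] by metis
  have "i = card T" if "i \<in> {1..card T}" "\<sigma> i < \<sigma> ?k" for i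
  proof (rule ccontr)
    assume "i \<noteq> card T"
    then have "\<sigma> ?k \<le> \<sigma> i" using that(1) k by (intro monotone_onD[OF anti]) auto
    with that(2) show False by simp
  qed
  then have "card {i \<in> {1..card T}. \<sigma> i < \<sigma> ?k} \<le> card {card T}" by (intro card_mono) auto
  then have few: "card {e \<in> T. edge_length d e < \<sigma> ?k} \<le> 1"
    using lists_edge_lengths_card[OF finT s, of "\<lambda>t. t < \<sigma> ?k"] by simp
  have few_eq: "e = e'" if "e \<in> T" "e' \<in> T" "edge_length d e < \<sigma> ?k" "edge_length d e' < \<sigma> ?k" for e e'
    using few that finT by (auto simp: card_le_Suc0_iff_eq)
  fix u v
  assume closest: "\<And>a b. \<lbrakk>a \<in> X; b \<in> X; a \<noteq> b\<rbrakk> \<Longrightarrow> d x y \<le> d a b"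
    and uv: "u \<in> X" "v \<in> X" "u \<noteq> v" "{u, v} \<noteq> {x, y}"
  show "\<sigma> ?k \<le> d u v"
  proof (rule ccontr)
    assume "\<not> \<sigma> ?k \<le> d u v"
    then have short: "d u v < \<sigma> ?k" "d x y < \<sigma> ?k" using closest[OF uv(1-3)] by auto
    have "{a, b} \<in> T" if "a \<in> X" "b \<in> X" "a \<noteq> b" "d a b < \<sigma> ?k" for a b
      using minimum_spanning_tree_two_shorter_edges[OF min that(1-3)] few_eq that(4)
      by (metis order_le_less_trans)
    then have "{u, v} \<in> T" "{x, y} \<in> T" using uv xy short by auto
    then have "{u, v} = {x, y}"
      using few_eq edge_length_pair[of d, OF sym] short by metis
    with uv(4) show False by simp
  qed
qed

end

section \<open>Distortion against a simplex with one point fewer\<close>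

lemma correspondence_obtain_left:
  assumes "correspondence Y X R"
  obtains h where "\<And>y. y \<in> Y \<Longrightarrow> (y, h y) \<in> R \<and> h y \<in> X"
proof -
  have "\<exists>x. (y, x) \<in> R \<and> x \<in> X" if "y \<in> Y" for y
    using assms that by (force simp: correspondence_def)
  with that show ?thesis by metis
qed

lemma correspondence_obtain_right:
  assumes "correspondence Y X R" "x \<in> X"
  obtains y where "y \<in> Y" "(y, x) \<in> R"
  using assms by (force simp: correspondence_def)

lemma finite_correspondence:
  "\<lbrakk>correspondence Y X R; finite Y; finite X\<rbrakk> \<Longrightarrow> finite R"
  unfolding correspondence_def by (meson finite_SigmaI finite_subset)

lemma distortion_simplex_distinct:
  assumes "finite R" "(i, x) \<in> R" "(j, y) \<in> R" "i \<noteq> j"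
  shows "\<bar>l - d x y\<bar> \<le> distortion (simplex_dist l) d R"
  using distortion_upper[OF assms(1-3), of "simplex_dist l" d] assms(4) by (simp add: simplex_dist_def)

context
  fixes X :: "'a set" and d and n :: nat and R and l :: real
  assumes X: "Metric_space X d" and fin: "finite X" and R: "correspondence {..<n} X R"
begin

lemma simplex_distortion_ge_min_dist:
  assumes card: "n < card X"
    and min: "\<And>u v. \<lbrakk>u \<in> X; v \<in> X; u \<noteq> v\<rbrakk> \<Longrightarrow> m \<le> d u v"
  shows "m \<le> distortion (simplex_dist l) d R"
proof -
  have "\<exists>i<n. (i, x) \<in> R" if "x \<in> X" for x
    using correspondence_obtain_right[OF R that] by auto
  then obtain g where g: "\<And>x. x \<in> X \<Longrightarrow> g x < n \<and> (g x, x) \<in> R" by metis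
  have "\<not> inj_on g X"
    using card g by (intro pigeonhole) (metis card_lessThan card_mono finite_lessThan image_subsetI
        lessThan_iff order_le_less_trans)
  then obtain x y where xy: "x \<in> X" "y \<in> X" "x \<noteq> y" "g x = g y"
    by (auto simp: inj_on_def)
  have "\<bar>simplex_dist l (g x) (g y) - d x y\<bar> \<le> distortion (simplex_dist l) d R"
    using g[OF xy(1)] g[OF xy(2)] finite_correspondence[OF R _ fin] by (intro distortion_upper) simp_all
  then show ?thesis using xy min[of x y] by (simp add: simplex_dist_def)
qed

lemma simplex_distortion_ge_dist_diff:
  assumes "0 < l" "x \<in> X" "y \<in> X"
  shows "d x y - l \<le> distortion (simplex_dist l) d R"
proof -
  obtain i j where ij: "(i, x) \<in> R" "(j, y) \<in> R"
    using correspondence_obtain_right[OF R] assms(2,3) by metis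
  have "\<bar>simplex_dist l i j - d x y\<bar> \<le> distortion (simplex_dist l) d R"
    using ij finite_correspondence[OF R _ fin] by (intro distortion_upper) auto
  then show ?thesis using assms(1) by (auto simp: simplex_dist_def split: if_splits)
qed

text \<open>Choose a point \<open>h i\<close> of \<open>X\<close> for every vertex \<open>i\<close>. If \<open>h\<close> identifies two vertices, the
  distortion is at least \<open>l\<close>. Otherwise \<open>h\<close> misses a single point \<open>z\<close>. A pair that avoids \<open>z\<close>
  comes from two distinct vertices. If both pairs contain \<open>z\<close>, their other ends belong to distinct
  vertices, and a vertex that corresponds to \<open>z\<close> differs from one of these.\<close>

lemma simplex_distortion_ge_diff_two_pairs:
  assumes card: "card X = Suc n"
    and xy: "x \<in> X" "y \<in> X" "x \<noteq> y" "d x y \<le> s"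
    and uv: "u \<in> X" "v \<in> X" "u \<noteq> v" "d u v \<le> s" and ne: "{u, v} \<noteq> {x, y}"
  shows "l - s \<le> distortion (simplex_dist l) d R"
proof -
  have finR: "finite R" using finite_correspondence[OF R _ fin] by simp
  note two = distortion_simplex_distinct[OF finR, of _ _ _ _ l d]
  have apart: ?thesis if "(i, a) \<in> R" "(j, b) \<in> R" "i \<noteq> j" "d a b \<le> s" for i j a b
    using two[OF that(1-3)] that(4) by linarith
  obtain h where h: "\<And>i. i < n \<Longrightarrow> (i, h i) \<in> R \<and> h i \<in> X"
    using correspondence_obtain_left[OF R] by (metis lessThan_iff)
  show ?thesis
  proof (cases "inj_on h {..<n}")
    case False
    then obtain i j where ij: "i < n" "j < n" "i \<noteq> j" "h i = h j" by (auto simp: inj_on_def)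
    moreover have "d (h i) (h j) \<le> s"
      using ij h[of i] Metric_space.zero[OF X, of "h i" "h i"] Metric_space.nonneg[OF X, of x y] xy(4)
      by simp
    ultimately show ?thesis using apart h by blast
  next
    case True
    have "card (X - h ` {..<n}) = 1"
      using True h card by (subst card_Diff_subset) (auto simp: card_image)
    then obtain z where z: "X - h ` {..<n} = {z}" by (auto simp: card_1_singleton_iff)
    have hit: "\<exists>i<n. a = h i" if "a \<in> X" "a \<noteq> z" for a
      using that z by blast
    have no_z: ?thesis if ab: "a \<in> X" "b \<in> X" "a \<noteq> b" "d a b \<le> s" "z \<notin> {a, b}" for a b
    proof -
      obtain i j where "i < n" "a = h i" "j < n" "b = h j" using hit ab by (metis insertCI)
      then show ?thesis using apart[of i a j b] ab h by metis
    qed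
    have with_z: "\<exists>b\<in>X. b \<noteq> z \<and> {a, c} = {z, b} \<and> d z b \<le> s"
      if "a \<in> X" "c \<in> X" "a \<noteq> c" "d a c \<le> s" "z \<in> {a, c}" for a c
      using that Metric_space.commute[OF X, of a c] by (metis insertE insert_commute singletonD)
    show ?thesis
    proof (cases "z \<in> {x, y} \<and> z \<in> {u, v}")
      case False
      then show ?thesis using no_z[of x y] no_z[of u v] xy uv by metis
    next
      case True
      obtain b where b: "b \<in> X" "b \<noteq> z" "{x, y} = {z, b}" "d z b \<le> s"
        using with_z[OF xy] True by blast
      obtain c where c: "c \<in> X" "c \<noteq> z" "{u, v} = {z, c}" "d z c \<le> s"
        using with_z[OF uv] True by blast
      obtain i where i: "i < n" "b = h i" using hit[OF b(1,2)] by blast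
      obtain j where j: "j < n" "c = h j" using hit[OF c(1,2)] by blast
      have "i \<noteq> j" using i j b(3) c(3) ne by auto
      have "z \<in> X" using z by blast
      then obtain k where k: "(k, z) \<in> R" using correspondence_obtain_right[OF R] by metis
      have "(i, b) \<in> R" "(j, c) \<in> R" using h i j by auto
      then show ?thesis
        using apart[OF k, of i b] apart[OF k, of j c] b(4) c(4) \<open>i \<noteq> j\<close> by metis
    qed
  qed
qed

end

definition merging_correspondence ::
  "nat \<Rightarrow> 'a \<Rightarrow> 'a \<Rightarrow> nat \<Rightarrow> (nat \<Rightarrow> 'a) \<Rightarrow> (nat \<times> 'a) set" where
  "merging_correspondence n x y p \<phi> = {(p, x), (p, y)} \<union> {(i, \<phi> i) | i. i \<in> {..<n} - {p}}"

lemma correspondence_merging: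
  assumes "x \<in> X" "y \<in> X" "p < n" "bij_betw \<phi> ({..<n} - {p}) (X - {x, y})"
  shows "correspondence {..<n} X (merging_correspondence n x y p \<phi>)"
proof -
  let ?R = "merging_correspondence n x y p \<phi>"
  have \<phi>: "\<phi> ` ({..<n} - {p}) = X - {x, y}" using assms(4) by (simp add: bij_betw_def)
  then have "\<phi> i \<in> X" if "i \<in> {..<n} - {p}" for i using that by blast
  then have "?R \<subseteq> {..<n} \<times> X" using assms(1-3) by (auto simp: merging_correspondence_def)
  moreover have "fst ` ?R = insert p ({..<n} - {p})"
    by (force simp: merging_correspondence_def)
  moreover have "snd ` ?R = {x, y} \<union> \<phi> ` ({..<n} - {p})"
    by (force simp: merging_correspondence_def)
  ultimately show ?thesis
    using \<phi> assms(1-3) unfolding correspondence_def by auto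
qed

lemma merging_correspondence_cases:
  assumes \<phi>: "bij_betw \<phi> ({..<n} - {p}) (X - {x, y})"
    and "(i, u) \<in> merging_correspondence n x y p \<phi>" "(j, v) \<in> merging_correspondence n x y p \<phi>"
  shows "i = j \<and> (u = v \<or> {u, v} = {x, y}) \<or> i \<noteq> j \<and> u \<noteq> v \<and> {u, v} \<noteq> {x, y}"
proof -
  have out: "\<phi> k \<notin> {x, y}" if "k < n" "k \<noteq> p" for k
    using bij_betw_apply[OF \<phi>, of k] that by auto
  have inj: "k = k'" if "\<phi> k = \<phi> k'" "k < n" "k \<noteq> p" "k' < n" "k' \<noteq> p" for k k'
    using \<phi> that by (auto simp: bij_betw_def inj_on_def)
  show ?thesis
    using assms(2,3) out inj unfolding merging_correspondence_def
    by (auto simp: doubleton_eq_iff)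
qed

lemma simplex_GH_distance:
  fixes X :: "'a set" and \<sigma> \<Sigma> :: "nat \<Rightarrow> real"
  assumes X: "Metric_space X d" "finite X" "card X = n" "2 \<le> n"
    and spec: "mst_spectrum X d \<sigma>" "xst_spectrum X d \<Sigma>" and l: "0 < l"
    and xy: "x \<in> X" "y \<in> X" "x \<noteq> y" and closest: "\<And>u v. \<lbrakk>u \<in> X; v \<in> X; u \<noteq> v\<rbrakk> \<Longrightarrow> d x y \<le> d u v"
    and p: "p < n - 1" and \<phi>: "bij_betw \<phi> ({..<n - 1} - {p}) (X - {x, y})"
  shows "2 * GH_distance {..<n - 1} (simplex_dist l) X d =
      Max ({\<sigma> (n - 1), \<Sigma> (n - 1) - l} \<union> (if 3 \<le> n then {l - \<sigma> (n - 2)} else {}))"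
    and "optimal_correspondence {..<n - 1} (simplex_dist l) X d (merging_correspondence (n - 1) x y p \<phi>)"
proof -
  define A where "A = {\<sigma> (n - 1), \<Sigma> (n - 1) - l} \<union> (if 3 \<le> n then {l - \<sigma> (n - 2)} else {})"
  have A: "finite A" "A \<noteq> {}" by (auto simp: A_def)
  let ?R = "merging_correspondence (n - 1) x y p \<phi>"
  let ?dis = "distortion (simplex_dist l) d"
  have sym: "\<And>a b. d a b = d b a" using Metric_space.commute[OF X(1)] .
  have dd: "d a a = 0" if "a \<in> X" for a using Metric_space.zero[OF X(1) that that] by simp
  note mst1 = mst_spectrum_last[OF X(2) sym spec(1), unfolded X(3), OF X(4)]
  note xst = xst_spectrum_last[OF X(2) sym spec(2), unfolded X(3), OF X(4)]
  note mst2 = mst_spectrum_second_last[OF X(2) sym spec(1) _ xy, unfolded X(3)]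
  have \<sigma>1: "\<sigma> (n - 1) = d x y" using mst1 closest xy by (metis order_antisym)
  have R: "correspondence {..<n - 1} X ?R" using xy p \<phi> by (intro correspondence_merging) auto
  have lower: "Max A \<le> ?dis S" if S: "correspondence {..<n - 1} X S" for S
  proof -
    have "\<sigma> (n - 1) \<le> ?dis S"
      using simplex_distortion_ge_min_dist[OF X(1,2) S] mst1(2) X(3,4) by simp
    moreover have "\<Sigma> (n - 1) - l \<le> ?dis S"
      using xst(1) simplex_distortion_ge_dist_diff[OF X(1,2) S l] by metis
    moreover have "l - \<sigma> (n - 2) \<le> ?dis S" if n: "3 \<le> n"
    proof -
      obtain u v where uv: "u \<in> X" "v \<in> X" "u \<noteq> v" "{u, v} \<noteq> {x, y}" "d u v \<le> \<sigma> (n - 2)"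
        using mst2(1)[OF n] by blast
      moreover have "d x y \<le> \<sigma> (n - 2)" using closest[OF uv(1-3)] uv(5) by simp
      moreover have "card X = Suc (n - 1)" using X(3,4) by simp
      ultimately show ?thesis
        using simplex_distortion_ge_diff_two_pairs[OF X(1,2) S] xy by metis
    qed
    ultimately show ?thesis using A by (auto simp: A_def)
  qed
  have upper: "?dis ?R \<le> Max A"
  proof (rule distortion_least)
    show "?R \<noteq> {}" by (simp add: merging_correspondence_def)
  next
    fix i u j v
    assume iu: "(i, u) \<in> ?R" and jv: "(j, v) \<in> ?R"
    have in_sp: "i < n - 1" "j < n - 1" "u \<in> X" "v \<in> X"
      using iu jv R by (auto simp: correspondence_def)
    have max: "a \<le> Max A" if "a \<in> A" for a using that A by simp
    consider "i = j" "u = v" | "i = j" "{u, v} = {x, y}" | "i \<noteq> j" "u \<noteq> v" "{u, v} \<noteq> {x, y}"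
      using merging_correspondence_cases[OF \<phi> iu jv] by blast
    then show "\<bar>simplex_dist l i j - d u v\<bar> \<le> Max A"
    proof cases
      case 1
      then show ?thesis
        using max[of "\<sigma> (n - 1)"] \<sigma>1 dd in_sp Metric_space.nonneg[OF X(1), of x y]
        by (simp add: A_def simplex_dist_def)
    next
      case 2
      then have "d u v = d x y" using sym by (auto simp: doubleton_eq_iff)
      then show ?thesis
        using 2(1) max[of "\<sigma> (n - 1)"] \<sigma>1 Metric_space.nonneg[OF X(1), of x y]
        by (simp add: A_def simplex_dist_def)
    next
      case 3
      \<comment> \<open>Two distinct vertices of the simplex exist only for \<open>n \<ge> 3\<close>.\<close>
      then have n: "3 \<le> n" using in_sp by linarith
      have "\<sigma> (n - 2) \<le> d u v" using mst2(2)[OF n] closest in_sp 3 by metis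
      moreover have "d u v \<le> \<Sigma> (n - 1)" using xst(2) in_sp 3 by metis
      moreover have "l - \<sigma> (n - 2) \<le> Max A" "\<Sigma> (n - 1) - l \<le> Max A"
        using n by (auto intro!: max simp: A_def)
      ultimately show ?thesis using 3(1) by (simp add: simplex_dist_def abs_le_iff)
    qed
  qed
  have dis: "?dis ?R = Max A" using upper lower[OF R] by simp
  have "0 < \<sigma> (n - 1)"
    using \<sigma>1 xy Metric_space.zero[OF X(1) xy(1,2)] Metric_space.nonneg[OF X(1), of x y] by linarith
  also have "\<dots> \<le> Max A" using A by (intro Max_ge) (auto simp: A_def)
  finally have GH: "GH_distance {..<n - 1} (simplex_dist l) X d = 1 / 2 * ?dis ?R"
    using p lower R X dis Metric_space_simplex[OF l]
    by (intro GH_distance_eq_half_distortion) auto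
  then show "optimal_correspondence {..<n - 1} (simplex_dist l) X d ?R"
    using R by (simp add: optimal_correspondence_def)
  show "2 * GH_distance {..<n - 1} (simplex_dist l) X d =
      Max ({\<sigma> (n - 1), \<Sigma> (n - 1) - l} \<union> (if 3 \<le> n then {l - \<sigma> (n - 2)} else {}))"
    using GH dis by (simp add: A_def)
qed

theorem theorem4p16:
  fixes X :: "'a set" and d :: "'a \<Rightarrow> 'a \<Rightarrow> real" and n :: nat
    and \<sigma> \<Sigma> :: "nat \<Rightarrow> real" and l :: real
  assumes "Metric_space X d" and "finite X" and "card X = n" and "2 \<le> n"
    and "mst_spectrum X d \<sigma>" and "xst_spectrum X d \<Sigma>"
    and "0 < l"
  shows "2 * GH_distance {..<n - 1} (simplex_dist l) X d =
           Max ({\<sigma> (n - 1), \<Sigma> (n - 1) - l} \<union> (if 3 \<le> n then {l - \<sigma> (n - 2)} else {})) \<and>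
         (\<forall>x y p \<phi>.
           x \<in> X \<and> y \<in> X \<and> x \<noteq> y \<and> (\<forall>u\<in>X. \<forall>v\<in>X. u \<noteq> v \<longrightarrow> d x y \<le> d u v) \<and>
           p \<in> {..<n - 1} \<and> bij_betw \<phi> ({..<n - 1} - {p}) (X - {x, y}) \<longrightarrow>
           optimal_correspondence {..<n - 1} (simplex_dist l) X d
             ({(p, x), (p, y)} \<union> {(i, \<phi> i) | i. i \<in> {..<n - 1} - {p}}))"
proof (intro conjI allI impI)
  have n: "card (X - {x, y}) = n - 2" if "x \<in> X" "y \<in> X" "x \<noteq> y" for x y
    using that assms(2,3) by (simp add: card_Diff_subset)
  obtain x y where xy: "x \<in> X" "y \<in> X" "x \<noteq> y" "d x y = \<sigma> (n - 1)"
    using mst_spectrum_last(1)[OF assms(2) Metric_space.commute[OF assms(1)] assms(5)] assms(3,4)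
    by auto
  have closest: "d x y \<le> d u v" if "u \<in> X" "v \<in> X" "u \<noteq> v" for u v
    using mst_spectrum_last(2)[OF assms(2) Metric_space.commute[OF assms(1)] assms(5) _ that]
      assms(3,4) xy(4) by simp
  have "card ({..<n - 1} - {0}) = card (X - {x, y})"
    using n[OF xy(1-3)] assms(4) by simp
  then obtain \<phi> where \<phi>: "bij_betw \<phi> ({..<n - 1} - {0}) (X - {x, y})"
    using finite_same_card_bij[of "{..<n - 1} - {0}" "X - {x, y}"] assms(2) by auto
  show "2 * GH_distance {..<n - 1} (simplex_dist l) X d =
      Max ({\<sigma> (n - 1), \<Sigma> (n - 1) - l} \<union> (if 3 \<le> n then {l - \<sigma> (n - 2)} else {}))"
    by (rule simplex_GH_distance(1)[OF assms xy(1-3) closest _ \<phi>]) (use assms(4) in simp_all)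
next
  fix x y p \<phi>
  assume "x \<in> X \<and> y \<in> X \<and> x \<noteq> y \<and> (\<forall>u\<in>X. \<forall>v\<in>X. u \<noteq> v \<longrightarrow> d x y \<le> d u v) \<and>
    p \<in> {..<n - 1} \<and> bij_betw \<phi> ({..<n - 1} - {p}) (X - {x, y})"
  then show "optimal_correspondence {..<n - 1} (simplex_dist l) X d
      ({(p, x), (p, y)} \<union> {(i, \<phi> i) | i. i \<in> {..<n - 1} - {p}})"
    using simplex_GH_distance(2)[OF assms, of x y p \<phi>]
    unfolding merging_correspondence_def by blast
qed

end
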